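(* Let $n\ge1$, $0\le m\le n-1$, and let $K$ be a pure $n$-simplicial complex. Then $K$ contains an $(m,n)$-simplicial cycle sequence if and only if there exists a sequence $\eta_1,\dots,\eta_r$ of at least three distinct $n$-simplices of $K$ such that (1) for each $2\le z\le r$, $\eta_{z-1}$ and $\eta_z$ have a common $(n-1)$-face; and (2) there exists an $m$-simplex $\sigma_1$ which is a face of both $\eta_1$ and $\eta_r$ but is not a face of $\eta_t$ for some $2\le t\le r-1$.
   Context: A simplicial complex on a finite vertex set is a collection of non-empty vertex subsets containing all singletons and closed under non-empty subsets; a $k$-simplex has $k+1$ vertices; $\tau$ is a face of $\sigma$ if $\tau\subseteq\sigma$. $K$ is a pure $n$-simplicial complex if $\dim K=n$ and every simplex is a face of some $n$-simplex. An $(m,n)$-walk sequence is an alternating sequence $\sigma_1,\eta_1,\sigma_2,\dots,\sigma_r,\eta_r,\sigma_{r+1}$ of $m$-simplices $\sigma_k$ and $n$-simplices $\eta_k$ with $\sigma_k\ne\sigma_{k+1}$ both faces of $\eta_k$. An $(m,n)$-simplicial cycle sequence is an $(m,n)$-walk sequence with $\sigma_{r+1}=\sigma_1$ and $\sigma_p\ne\sigma_q$, $\eta_p\ne\eta_q$ for $1\le p\ne q\le r$, such that (i) $r\ge 3$; (ii) $\sigma_1$ is not a face of $\eta_k$ for $2\le k\le r-1$; (iii) for each $2\le z\le r$ there is an $(n-1)$-simplex $\sigma'_z$ of $K$ which is a face of both $\eta_{z-1}$ and $\eta_z$ and has $\sigma_z$ as a face, with $\sigma'_x\ne\sigma'_y$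 for $2\le x\ne y\le r$. *)

theory Defs
  imports Main
begin

definition simplicial_complex :: "'a set \<Rightarrow> 'a set set \<Rightarrow> bool" where
  "simplicial_complex V K \<longleftrightarrow>
     finite V \<and>
     (\<forall>\<sigma>\<in>K. \<sigma> \<noteq> {} \<and> \<sigma> \<subseteq> V) \<and>
     (\<forall>v\<in>V. {v} \<in> K) \<and>
     (\<forall>\<sigma>\<in>K. \<forall>\<tau>. \<tau> \<noteq> {} \<and> \<tau> \<subseteq> \<sigma> \<longrightarrow> \<tau> \<in> K)"

definition is_simplex :: "'a set set \<Rightarrow> nat \<Rightarrow> 'a set \<Rightarrow> bool" where
  "is_simplex K k \<sigma> \<longleftrightarrow> \<sigma> \<in> K \<and> card \<sigma> = k + 1"

definition face_of_simplex :: "'a set \<Rightarrow> 'a set \<Rightarrow> bool" where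
  "face_of_simplex \<tau> \<sigma> \<longleftrightarrow> \<tau> \<subseteq> \<sigma>"

definition complex_dim :: "'a set set \<Rightarrow> nat" where
  "complex_dim K = Max ((\<lambda>\<sigma>. card \<sigma> - 1) ` K)"

text \<open>Non-emptiness is required because \<^term>\<open>complex_dim {}\<close> is an unspecified number.\<close>

definition pure_simplicial_complex :: "nat \<Rightarrow> 'a set \<Rightarrow> 'a set set \<Rightarrow> bool" where
  "pure_simplicial_complex n V K \<longleftrightarrow>
     simplicial_complex V K \<and> K \<noteq> {} \<and> complex_dim K = n \<and>
     (\<forall>\<tau>\<in>K. \<exists>\<sigma>. is_simplex K n \<sigma> \<and> face_of_simplex \<tau> \<sigma>)"

text \<open>Sequences are functions on the naturals of which only the entries
  \<open>\<sigma> 1, \<dots>, \<sigma> (r + 1)\<close> and \<open>\<eta> 1, \<dots>, \<eta> r\<close> are relevant.\<close>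

definition walk_sequence ::
  "'a set set \<Rightarrow> nat \<Rightarrow> nat \<Rightarrow> nat \<Rightarrow> (nat \<Rightarrow> 'a set) \<Rightarrow> (nat \<Rightarrow> 'a set) \<Rightarrow> bool" where
  "walk_sequence K m n r \<sigma> \<eta> \<longleftrightarrow>
     (\<forall>k\<in>{1..r + 1}. is_simplex K m (\<sigma> k)) \<and>
     (\<forall>k\<in>{1..r}. is_simplex K n (\<eta> k)) \<and>
     (\<forall>k\<in>{1..r}. \<sigma> k \<noteq> \<sigma> (k + 1) \<and>
        face_of_simplex (\<sigma> k) (\<eta> k) \<and> face_of_simplex (\<sigma> (k + 1)) (\<eta> k))"

definition simplicial_cycle_sequence ::
  "'a set set \<Rightarrow> nat \<Rightarrow> nat \<Rightarrow> nat \<Rightarrow> (nat \<Rightarrow> 'a set) \<Rightarrow> (nat \<Rightarrow> 'a set) \<Rightarrow> bool" where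
  "simplicial_cycle_sequence K m n r \<sigma> \<eta> \<longleftrightarrow>
     walk_sequence K m n r \<sigma> \<eta> \<and>
     \<sigma> (r + 1) = \<sigma> 1 \<and>
     inj_on \<sigma> {1..r} \<and> inj_on \<eta> {1..r} \<and>
     r \<ge> 3 \<and>
     (\<forall>k\<in>{2..r - 1}. \<not> face_of_simplex (\<sigma> 1) (\<eta> k)) \<and>
     (\<exists>\<sigma>'. (\<forall>z\<in>{2..r}. is_simplex K (n - 1) (\<sigma>' z) \<and>
               face_of_simplex (\<sigma>' z) (\<eta> (z - 1)) \<and> face_of_simplex (\<sigma>' z) (\<eta> z) \<and>
               face_of_simplex (\<sigma> z) (\<sigma>' z)) \<and>
           inj_on \<sigma>' {2..r})"

end

theory Submission imports Defs begin

text \<open>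
  For the converse direction take a sequence \<open>\<eta>\<^sub>1, \<dots>, \<eta>\<^sub>r\<close> that is shortest among all
  sequences satisfying (1) and (2), for all possible choices of the \<open>m\<close>-simplex in (2).
  Minimality has two consequences: no \<open>m\<close>-simplex leaves the sequence and re-enters it, except
  possibly between the two ends, and three consecutive \<open>n\<close>-simplices never share an
  \<open>(n-1)\<close>-face, since the middle one could be skipped. Hence the common face \<open>\<sigma>'\<^sub>z\<close> of
  \<open>\<eta>\<^sub>z\<^sub>-\<^sub>1\<close> and \<open>\<eta>\<^sub>z\<close> contains a vertex outside \<open>\<eta>\<^sub>z\<^sub>-\<^sub>2\<close>. An \<open>m\<close>-face \<open>\<sigma>\<^sub>z\<close> of \<open>\<sigma>'\<^sub>z\<close> through this
  vertex is new at position \<open>z - 1\<close>, hence not contained in any earlier \<open>\<sigma>'\<^sub>y\<close>. This makes both the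
  \<open>\<sigma>\<^sub>z\<close> and the \<open>\<sigma>'\<^sub>z\<close> pairwise distinct.
\<close>

section \<open>Paths of \<open>n\<close>-simplices through common \<open>(n-1)\<close>-faces, and
  their subsequences\<close>

definition face_path :: "'a set set \<Rightarrow> nat \<Rightarrow> nat \<Rightarrow> (nat \<Rightarrow> 'a set) \<Rightarrow> bool" where
  "face_path K n r \<eta> \<longleftrightarrow>
     (\<forall>k\<in>{1..r}. is_simplex K n (\<eta> k)) \<and> inj_on \<eta> {1..r} \<and>
     (\<forall>z\<in>{2..r}. \<exists>\<tau>. is_simplex K (n - 1) \<tau> \<and> \<tau> \<subseteq> \<eta> (z - 1) \<and> \<tau> \<subseteq> \<eta> z)"

text \<open>The \<open>m\<close>-simplex is an argument, so that minimality of \<open>r\<close> can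
  be tested against paths returning to other \<open>m\<close>-simplices.\<close>

definition returning_path ::
    "'a set set \<Rightarrow> nat \<Rightarrow> nat \<Rightarrow> nat \<Rightarrow> (nat \<Rightarrow> 'a set) \<Rightarrow> 'a set \<Rightarrow> bool" where
  "returning_path K m n r \<eta> \<sigma> \<longleftrightarrow>
     r \<ge> 3 \<and> face_path K n r \<eta> \<and> is_simplex K m \<sigma> \<and> \<sigma> \<subseteq> \<eta> 1 \<and> \<sigma> \<subseteq> \<eta> r \<and>
     (\<exists>t\<in>{2..r - 1}. \<not> \<sigma> \<subseteq> \<eta> t)"

lemma face_path_segment:
  assumes "face_path K n r \<eta>" "1 \<le> i" "j \<le> r"
  shows "face_path K n (j + 1 - i) (\<lambda>k. \<eta> (k + i - 1))"
  unfolding face_path_def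
proof (intro conjI ballI)
  show "is_simplex K n (\<eta> (k + i - 1))" if "k \<in> {1..j + 1 - i}" for k
  proof -
    have "k + i - 1 \<in> {1..r}" using that assms(2,3) by auto
    then show ?thesis using assms(1) unfolding face_path_def by blast
  qed
  have inj: "inj_on \<eta> {1..r}"
    using assms(1) by (simp add: face_path_def)
  show "inj_on (\<lambda>k. \<eta> (k + i - 1)) {1..j + 1 - i}"
  proof (rule inj_onI)
    fix x y assume "x \<in> {1..j + 1 - i}" "y \<in> {1..j + 1 - i}" "\<eta> (x + i - 1) = \<eta> (y + i - 1)"
    moreover from this assms(2,3) have "x + i - 1 \<in> {1..r}" "y + i - 1 \<in> {1..r}"
      by auto
    ultimately have "x + i - 1 = y + i - 1" using inj by (metis inj_onD)
    with assms(2) show "x = y" by simp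
  qed
  fix z assume z: "z \<in> {2..j + 1 - i}"
  then have "z + i - 1 \<in> {2..r}" "z - 1 + i - 1 = z + i - 1 - 1"
    using assms(2,3) by auto
  then show "\<exists>\<tau>. is_simplex K (n - 1) \<tau> \<and> \<tau> \<subseteq> \<eta> (z - 1 + i - 1) \<and> \<tau> \<subseteq> \<eta> (z + i - 1)"
    using assms(1) unfolding face_path_def by metis
qed

text \<open>Only the step across the gap needs a new common face, and \<open>\<tau>\<close> is that
  face.\<close>

lemma face_path_skip:
  assumes path: "face_path K n r \<eta>" and p: "2 \<le> p" "p < r"
    and \<tau>: "is_simplex K (n - 1) \<tau>" "\<tau> \<subseteq> \<eta> (p - 1)" "\<tau> \<subseteq> \<eta> (p + 1)"
  shows "face_path K n (r - 1) (\<lambda>k. \<eta> (if k < p then k else k + 1))"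
  unfolding face_path_def
proof (intro conjI ballI)
  show "is_simplex K n (\<eta> (if k < p then k else k + 1))" if "k \<in> {1..r - 1}" for k
    using that path by (auto simp: face_path_def)
  have inj: "inj_on \<eta> {1..r}"
    using path by (simp add: face_path_def)
  show "inj_on (\<lambda>k. \<eta> (if k < p then k else k + 1)) {1..r - 1}"
  proof (rule inj_onI)
    fix x y assume xy: "x \<in> {1..r - 1}" "y \<in> {1..r - 1}"
      "\<eta> (if x < p then x else x + 1) = \<eta> (if y < p then y else y + 1)"
    then have "(if x < p then x else x + 1) \<in> {1..r}" "(if y < p then y else y + 1) \<in> {1..r}"
      by auto
    with inj xy(3) have "(if x < p then x else x + 1) = (if y < p then y else y + 1)"
      by (metis inj_onD)
    then show "x = y" by (auto split: if_splits)
  qed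
  fix z assume z: "z \<in> {2..r - 1}"
  have step: "\<exists>\<tau>. is_simplex K (n - 1) \<tau> \<and> \<tau> \<subseteq> \<eta> (z - 1) \<and> \<tau> \<subseteq> \<eta> z" if "z \<in> {2..r}" for z
    using path that by (simp add: face_path_def)
  consider "z < p" | "z = p" | "z > p" by linarith
  then show "\<exists>\<tau>. is_simplex K (n - 1) \<tau> \<and> \<tau> \<subseteq> \<eta> (if z - 1 < p then z - 1 else z - 1 + 1) \<and>
      \<tau> \<subseteq> \<eta> (if z < p then z else z + 1)"
  proof cases
    case 1
    then show ?thesis using step[of z] z by auto
  next
    case 2
    then show ?thesis using \<tau> p by auto
  next
    case 3
    then show ?thesis using step[of "z + 1"] z by auto
  qed
qed

section \<open>Properties of shortest returning paths\<close>

text \<open>Otherwise the segment from \<open>i\<close> to \<open>j\<close> would be a returning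
  path for \<open>\<tau>\<close>. The bound \<open>j + 1 - i < r\<close> makes it strictly shorter
  and rules out just the case \<open>i = 1\<close>, \<open>j = r\<close>.\<close>

lemma shortest_returning_path_no_reentry:
  assumes path: "returning_path K m n r \<eta> \<sigma>"
    and shortest: "\<forall>r' \<eta>' \<sigma>'. returning_path K m n r' \<eta>' \<sigma>' \<longrightarrow> r \<le> r'"
    and ij: "1 \<le> i" "i < t" "t < j" "j \<le> r" "j + 1 - i < r"
    and \<tau>: "is_simplex K m \<tau>" "\<tau> \<subseteq> \<eta> i" "\<tau> \<subseteq> \<eta> j"
  shows "\<tau> \<subseteq> \<eta> t"
proof (rule ccontr)
  assume t: "\<not> \<tau> \<subseteq> \<eta> t"
  have "returning_path K m n (j + 1 - i) (\<lambda>k. \<eta> (k + i - 1)) \<tau>"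
    unfolding returning_path_def
  proof (intro conjI bexI)
    show "face_path K n (j + 1 - i) (\<lambda>k. \<eta> (k + i - 1))"
      using path ij by (intro face_path_segment) (auto simp: returning_path_def)
    show "\<not> \<tau> \<subseteq> \<eta> (t + 1 - i + i - 1)" "t + 1 - i \<in> {2..j + 1 - i - 1}"
      using t ij by auto
  qed (use \<tau> ij in auto)
  from shortest[rule_format, OF this] ij show False by simp
qed

text \<open>Upgrades "some interior position" to "every interior position", as condition (ii)
  demands. If \<open>\<eta> k\<close> contained \<open>\<sigma>\<close> and \<open>\<eta> t\<close>
  did not, then \<open>\<sigma>\<close> would leave and re-enter on the segment from
  \<open>1\<close> to \<open>k\<close> or on that from \<open>k\<close> to \<open>r\<close>.\<close>

lemma shortest_returning_path_interior:
  assumes path: "returning_path K m n r \<eta> \<sigma>"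
    and shortest: "\<forall>r' \<eta>' \<sigma>'. returning_path K m n r' \<eta>' \<sigma>' \<longrightarrow> r \<le> r'"
    and k: "k \<in> {2..r - 1}"
  shows "\<not> \<sigma> \<subseteq> \<eta> k"
proof
  assume sub: "\<sigma> \<subseteq> \<eta> k"
  obtain t where t: "t \<in> {2..r - 1}" "\<not> \<sigma> \<subseteq> \<eta> t"
    and \<sigma>: "is_simplex K m \<sigma>" "\<sigma> \<subseteq> \<eta> 1" "\<sigma> \<subseteq> \<eta> r"
    using path unfolding returning_path_def by blast
  note no_reentry = shortest_returning_path_no_reentry[OF path shortest]
  consider "t < k" | "k < t" using sub t by (metis linorder_less_linear)
  then show False
  proof cases
    case 1
    have "\<sigma> \<subseteq> \<eta> t"
      using 1 k t(1) sub \<sigma> by (intro no_reentry[of 1 t k \<sigma>]) auto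
    with t(2) show False ..
  next
    case 2
    have "\<sigma> \<subseteq> \<eta> t"
      using 2 k t(1) sub \<sigma> by (intro no_reentry[of k t r \<sigma>]) auto
    with t(2) show False ..
  qed
qed

text \<open>Dropping \<open>\<eta> p\<close> keeps both ends, so for \<open>r > 3\<close> a shorter
  path returning to \<open>\<sigma>\<close> would remain.\<close>

lemma shortest_returning_path_no_triple_face:
  assumes "1 \<le> n" and path: "returning_path K m n r \<eta> \<sigma>"
    and shortest: "\<forall>r' \<eta>' \<sigma>'. returning_path K m n r' \<eta>' \<sigma>' \<longrightarrow> r \<le> r'"
    and p: "2 \<le> p" "p < r"
    and \<tau>: "is_simplex K (n - 1) \<tau>" "\<tau> \<subseteq> \<eta> p" "\<tau> \<subseteq> \<eta> (p + 1)"
  shows "\<not> \<tau> \<subseteq> \<eta> (p - 1)"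
proof
  assume sub: "\<tau> \<subseteq> \<eta> (p - 1)"
  have r: "r \<ge> 3" and fp: "face_path K n r \<eta>" and \<sigma>: "is_simplex K m \<sigma>" "\<sigma> \<subseteq> \<eta> 1" "\<sigma> \<subseteq> \<eta> r"
    using path by (auto simp: returning_path_def)
  note interior = shortest_returning_path_interior[OF path shortest]
  show False
  proof (cases "r = 3")
    \<comment> \<open>Dropping the middle would leave only two simplices. Instead, two distinct sets
      of \<open>n + 1\<close> vertices share at most \<open>n\<close>, so \<open>\<tau>\<close> is
      all of \<open>\<eta> 1 \<inter> \<eta> 3\<close>; then \<open>\<sigma>\<close> lies in
      \<open>\<tau>\<close> and hence in \<open>\<eta> 2\<close>.\<close>
    case True
    with p have p: "p = 2" by simp
    have simplex: "is_simplex K n (\<eta> 1)" "is_simplex K n (\<eta> 3)"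
      using fp r by (auto simp: face_path_def)
    then have fin: "finite (\<eta> 1)" "finite (\<eta> 3)" and card: "card (\<eta> 1) = n + 1" "card (\<eta> 3) = n + 1"
      by (auto simp: is_simplex_def intro!: card_ge_0_finite)
    have "\<eta> 1 \<noteq> \<eta> 3"
      using fp r inj_onD[of \<eta> "{1..r}" 1 3] by (auto simp: face_path_def)
    then have "\<not> \<eta> 1 \<subseteq> \<eta> 3"
      using fin card by (metis card_subset_eq)
    then have "card (\<eta> 1 \<inter> \<eta> 3) < card (\<eta> 1)"
      using fin by (intro psubset_card_mono) auto
    then have "card (\<eta> 1 \<inter> \<eta> 3) \<le> card \<tau>"
      using card \<tau>(1) \<open>1 \<le> n\<close> by (simp add: is_simplex_def)
    moreover have "\<tau> \<subseteq> \<eta> 1 \<inter> \<eta> 3"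
      using sub \<tau>(3) p by simp
    ultimately have "\<tau> = \<eta> 1 \<inter> \<eta> 3"
      using fin by (intro card_seteq) auto
    then have "\<sigma> \<subseteq> \<eta> 2"
      using \<sigma> \<tau>(2) p True by auto
    with interior[of 2] True show False by simp
  next
    case False
    have "returning_path K m n (r - 1) (\<lambda>k. \<eta> (if k < p then k else k + 1)) \<sigma>"
      unfolding returning_path_def
    proof (intro conjI bexI)
      show "face_path K n (r - 1) (\<lambda>k. \<eta> (if k < p then k else k + 1))"
        using fp p \<tau> sub by (intro face_path_skip) auto
      \<comment> \<open>After the deletion, position 2 holds \<open>\<eta> 2\<close> or
        \<open>\<eta> 3\<close>; both were interior because \<open>r\<close> is at least 4.\<close>
      show "\<not> \<sigma> \<subseteq> \<eta> (if 2 < p then 2 else 2 + 1)" "2 \<in> {2..r - 1 - 1}"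
        using interior[of 2] interior[of 3] False r by auto
    qed (use \<sigma> p r False in auto)
    from shortest[rule_format, OF this] r show False by simp
  qed
qed

section \<open>Construction of the cycle sequence\<close>

lemma is_simplex_subset_through:
  assumes "simplicial_complex V K" "is_simplex K l \<rho>" "m \<le> l" "x \<in> \<rho>"
  shows "\<exists>\<tau>. is_simplex K m \<tau> \<and> \<tau> \<subseteq> \<rho> \<and> x \<in> \<tau>"
proof -
  have \<rho>: "\<rho> \<in> K" "card \<rho> = l + 1" using assms(2) by (auto simp: is_simplex_def)
  then have "finite \<rho>" by (intro card_ge_0_finite) simp
  with \<rho> assms(3,4) have "m \<le> card (\<rho> - {x})" by simp
  then obtain \<tau> where \<tau>: "\<tau> \<subseteq> \<rho> - {x}" "card \<tau> = m" "finite \<tau>"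
    by (rule obtain_subset_with_card_n)
  then have sub: "insert x \<tau> \<subseteq> \<rho>" and card: "card (insert x \<tau>) = m + 1"
    using assms(4) by (auto simp: card_insert_if)
  have "\<forall>\<sigma>\<in>K. \<forall>\<tau>. \<tau> \<noteq> {} \<and> \<tau> \<subseteq> \<sigma> \<longrightarrow> \<tau> \<in> K"
    using assms(1) unfolding simplicial_complex_def by (elim conjE)
  then have "insert x \<tau> \<in> K" using \<rho>(1) sub by (metis insert_not_empty)
  with card have "is_simplex K m (insert x \<tau>)" by (simp add: is_simplex_def)
  with sub show ?thesis by blast
qed

lemma shortest_returning_path_imp_cycle_sequence:
  assumes "1 \<le> n" "m \<le> n - 1" and K: "simplicial_complex V K"
    and path: "returning_path K m n r \<eta> \<sigma>\<^sub>1"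
    and shortest: "\<forall>r' \<eta>' \<sigma>'. returning_path K m n r' \<eta>' \<sigma>' \<longrightarrow> r \<le> r'"
  shows "\<exists>\<sigma>. simplicial_cycle_sequence K m n r \<sigma> \<eta>"
proof -
  have r: "r \<ge> 3" and fp: "face_path K n r \<eta>"
    and \<sigma>\<^sub>1: "is_simplex K m \<sigma>\<^sub>1" "\<sigma>\<^sub>1 \<subseteq> \<eta> 1" "\<sigma>\<^sub>1 \<subseteq> \<eta> r"
    using path by (auto simp: returning_path_def)
  note no_reentry = shortest_returning_path_no_reentry[OF path shortest]
  note interior = shortest_returning_path_interior[OF path shortest]
  obtain \<sigma>' where \<sigma>': "\<And>z. z \<in> {2..r} \<Longrightarrow>
      is_simplex K (n - 1) (\<sigma>' z) \<and> \<sigma>' z \<subseteq> \<eta> (z - 1) \<and> \<sigma>' z \<subseteq> \<eta> z"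
    using fp unfolding face_path_def by metis
  \<comment> \<open>The guard \<open>3 \<le> z\<close> is there because for \<open>z = 2\<close> the
    index \<open>z - 2\<close> is 0, which is not a position of the path.\<close>
  have "\<exists>\<tau>. is_simplex K m \<tau> \<and> \<tau> \<subseteq> \<sigma>' z \<and> (3 \<le> z \<longrightarrow> \<not> \<tau> \<subseteq> \<eta> (z - 2))"
    if z: "z \<in> {2..r}" for z
  proof -
    have "\<exists>x\<in>\<sigma>' z. 3 \<le> z \<longrightarrow> x \<notin> \<eta> (z - 2)"
    proof (cases "3 \<le> z")
      case True
      \<comment> \<open>The three consecutive simplices sit at \<open>z - 2\<close>,
        \<open>z - 1\<close> and \<open>z\<close>, so \<open>p\<close> is
        \<open>z - 1\<close>.\<close>
      then have "\<not> \<sigma>' z \<subseteq> \<eta> (z - 1 - 1)"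
        using z \<sigma>'[OF z]
        by (intro shortest_returning_path_no_triple_face[OF \<open>1 \<le> n\<close> path shortest]) auto
      moreover have "z - 1 - 1 = z - 2" by simp
      ultimately show ?thesis by auto
    next
      case False
      have "\<sigma>' z \<noteq> {}" using \<sigma>'[OF z] by (auto simp: is_simplex_def)
      with False show ?thesis by auto
    qed
    then obtain x where "x \<in> \<sigma>' z" "3 \<le> z \<longrightarrow> x \<notin> \<eta> (z - 2)" by blast
    with is_simplex_subset_through[OF K _ \<open>m \<le> n - 1\<close>] \<sigma>'[OF z] show ?thesis
      by (metis subsetD)
  qed
  then obtain f where f: "\<And>z. z \<in> {2..r} \<Longrightarrow>
      is_simplex K m (f z) \<and> f z \<subseteq> \<sigma>' z \<and> (3 \<le> z \<longrightarrow> \<not> f z \<subseteq> \<eta> (z - 2))"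
    by metis
  \<comment> \<open>If it were contained, \<open>f z'\<close> would lie in the simplices at
    \<open>z - 1\<close> and \<open>z' - 1\<close> but not in the one at \<open>z' - 2\<close>. For
    \<open>z' = z + 1\<close> the first and last of these positions coincide, an immediate
    contradiction; otherwise this is a forbidden re-entry.\<close>
  have new: "\<not> f z' \<subseteq> \<sigma>' z" if z: "2 \<le> z" "z < z'" "z' \<le> r" for z z'
  proof
    assume "f z' \<subseteq> \<sigma>' z"
    then have early: "f z' \<subseteq> \<eta> (z - 1)" using \<sigma>'[of z] z by auto
    have late: "f z' \<subseteq> \<eta> (z' - 1)" using f[of z'] \<sigma>'[of z'] z by auto
    have gap: "\<not> f z' \<subseteq> \<eta> (z' - 2)" using f[of z'] z by auto
    with early have "z - 1 \<noteq> z' - 2" by metis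
    then have "1 \<le> z - 1" "z - 1 < z' - 2" "z' - 2 < z' - 1" "z' - 1 \<le> r" "z' - 1 + 1 - (z - 1) < r"
      using z by auto
    moreover have "is_simplex K m (f z')" using f[of z'] z by simp
    ultimately have "f z' \<subseteq> \<eta> (z' - 2)" using early late by (rule no_reentry)
    with gap show False ..
  qed
  \<comment> \<open>\<open>f z\<close> lies in two consecutive simplices of the path; as
    \<open>r \<ge> 3\<close>, one of them is interior and so does not contain
    \<open>\<sigma>\<^sub>1\<close>.\<close>
  have f_ne: "f z \<noteq> \<sigma>\<^sub>1" if z: "z \<in> {2..r}" for z
  proof -
    have "f z \<subseteq> \<eta> (z - 1)" "f z \<subseteq> \<eta> z" using f[OF z] \<sigma>'[OF z] by auto
    moreover have "z \<in> {2..r - 1} \<or> z - 1 \<in> {2..r - 1}" using z r by auto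
    ultimately show ?thesis using interior by auto
  qed
  \<comment> \<open>For \<open>x < y\<close>, either of \<open>f x = f y\<close> and
    \<open>\<sigma>' x = \<sigma>' y\<close> would put \<open>f y\<close> inside
    \<open>\<sigma>' x\<close>, against \<open>new\<close>.\<close>
  have inj_f: "f x \<noteq> f y" if "x \<in> {2..r}" "y \<in> {2..r}" "x \<noteq> y" for x y
    using that new[of x y] new[of y x] f[of x] f[of y] by (cases "x < y") auto
  have inj_\<sigma>': "inj_on \<sigma>' {2..r}"
  proof (rule inj_onI, rule ccontr)
    fix x y assume "x \<in> {2..r}" "y \<in> {2..r}" "\<sigma>' x = \<sigma>' y" "x \<noteq> y"
    then show False
      using new[of x y] new[of y x] f[of x] f[of y] by (cases "x < y") auto
  qed
  \<comment> \<open>Positions \<open>1\<close> and \<open>r + 1\<close> both receive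
    \<open>\<sigma>\<^sub>1\<close>, which closes the cycle.\<close>
  define \<sigma> where "\<sigma> k = (if k \<in> {2..r} then f k else \<sigma>\<^sub>1)" for k
  have \<sigma>_f: "\<sigma> k = f k" if "k \<in> {2..r}" for k using that by (simp add: \<sigma>_def)
  have \<sigma>_ends: "\<sigma> 1 = \<sigma>\<^sub>1" "\<sigma> (r + 1) = \<sigma>\<^sub>1" by (simp_all add: \<sigma>_def)
  have inj_\<sigma>: "inj_on \<sigma> {1..r}"
  proof (rule inj_onI, rule ccontr)
    fix x y assume "x \<in> {1..r}" "y \<in> {1..r}" "\<sigma> x = \<sigma> y" "x \<noteq> y"
    then show False
      using inj_f[of x y] f_ne[of x] f_ne[of y] by (auto simp: \<sigma>_def split: if_splits)
  qed
  have walk: "walk_sequence K m n r \<sigma> \<eta>"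
    unfolding walk_sequence_def face_of_simplex_def
  proof (intro conjI ballI)
    show "is_simplex K m (\<sigma> k)" if "k \<in> {1..r + 1}" for k
      using f \<sigma>\<^sub>1 by (simp add: \<sigma>_def)
    show "is_simplex K n (\<eta> k)" if "k \<in> {1..r}" for k
      using fp that by (simp add: face_path_def)
    fix k assume k: "k \<in> {1..r}"
    \<comment> \<open>Injectivity stops at \<open>r\<close>, so the closing step from
      \<open>\<sigma> r\<close> back to \<open>\<sigma>\<^sub>1\<close> relies on
      \<open>f_ne\<close>.\<close>
    show "\<sigma> k \<noteq> \<sigma> (k + 1)"
    proof (cases "k = r")
      case True
      then show ?thesis using f_ne[of r] r \<sigma>_f[of r] \<sigma>_ends by auto
    next
      case False
      then show ?thesis using inj_onD[OF inj_\<sigma>, of k "k + 1"] k by auto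
    qed
    show "\<sigma> k \<subseteq> \<eta> k"
    proof (cases "k = 1")
      case True
      then show ?thesis using \<sigma>\<^sub>1 \<sigma>_ends by simp
    next
      case False
      then show ?thesis using k \<sigma>_f[of k] f[of k] \<sigma>'[of k] by auto
    qed
    show "\<sigma> (k + 1) \<subseteq> \<eta> k"
    proof (cases "k = r")
      case True
      then show ?thesis using \<sigma>\<^sub>1 \<sigma>_ends by simp
    next
      case False
      then show ?thesis using k \<sigma>_f[of "k + 1"] f[of "k + 1"] \<sigma>'[of "k + 1"] by auto
    qed
  qed
  have "simplicial_cycle_sequence K m n r \<sigma> \<eta>"
    unfolding simplicial_cycle_sequence_def face_of_simplex_def
  proof (intro conjI exI[of _ \<sigma>'] ballI)
    show "inj_on \<eta> {1..r}" using fp by (simp add: face_path_def)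
    show "\<not> \<sigma> 1 \<subseteq> \<eta> k" if "k \<in> {2..r - 1}" for k
      using interior[OF that] \<sigma>_ends by simp
    show "\<sigma> z \<subseteq> \<sigma>' z" if "z \<in> {2..r}" for z
      using f[OF that] \<sigma>_f[OF that] by simp
  qed (use walk \<sigma>_ends inj_\<sigma> inj_\<sigma>' r \<sigma>' in auto)
  then show ?thesis by blast
qed

section \<open>The two directions of the equivalence\<close>

lemma returning_path_imp_cycle_sequence:
  assumes "1 \<le> n" "m \<le> n - 1" "simplicial_complex V K" "returning_path K m n r \<eta> \<sigma>\<^sub>1"
  shows "\<exists>r \<sigma> \<eta>. simplicial_cycle_sequence K m n r \<sigma> \<eta>"
proof -
  \<comment> \<open>Path and \<open>m\<close>-simplex are quantified inside \<open>P\<close>, so the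
    least length is taken over all choices of both.\<close>
  define P where "P r \<longleftrightarrow> (\<exists>\<eta> \<sigma>. returning_path K m n r \<eta> \<sigma>)" for r
  have "P (LEAST r. P r)"
    using assms(4) by (intro LeastI[of P r]) (auto simp: P_def)
  then obtain \<eta>' \<sigma>' where "returning_path K m n (LEAST r. P r) \<eta>' \<sigma>'"
    by (auto simp: P_def)
  moreover have "(LEAST r. P r) \<le> r'" if "returning_path K m n r' \<eta>'' \<sigma>''" for r' \<eta>'' \<sigma>''
    using that by (intro Least_le) (auto simp: P_def)
  ultimately show ?thesis
    using shortest_returning_path_imp_cycle_sequence[OF assms(1-3)] by blast
qed

text \<open>The path is kept, and since \<open>r \<ge> 3\<close>, position 2 is interior and
  witnesses that \<open>\<sigma> 1\<close> is missed.\<close>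

lemma cycle_sequence_imp_returning_path:
  assumes "simplicial_cycle_sequence K m n r \<sigma> \<eta>"
  shows "returning_path K m n r \<eta> (\<sigma> 1)"
  unfolding returning_path_def face_path_def
proof (intro conjI bexI[of _ 2])
  have r: "r \<ge> 3" and closed: "\<sigma> (r + 1) = \<sigma> 1" and walk: "walk_sequence K m n r \<sigma> \<eta>"
    using assms by (auto simp: simplicial_cycle_sequence_def)
  show "\<sigma> 1 \<subseteq> \<eta> 1" "is_simplex K m (\<sigma> 1)"
    using walk r by (auto simp: walk_sequence_def face_of_simplex_def)
  have "\<sigma> (r + 1) \<subseteq> \<eta> r"
    using walk r by (simp add: walk_sequence_def face_of_simplex_def)
  then show "\<sigma> 1 \<subseteq> \<eta> r" using closed by simp
  show "\<not> \<sigma> 1 \<subseteq> \<eta> 2" "2 \<in> {2..r - 1}"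
    using assms r by (auto simp: simplicial_cycle_sequence_def face_of_simplex_def)
  show "3 \<le> r" by (fact r)
  show "\<forall>k\<in>{1..r}. is_simplex K n (\<eta> k)"
    using walk by (simp add: walk_sequence_def)
  show "inj_on \<eta> {1..r}"
    using assms by (simp add: simplicial_cycle_sequence_def)
  show "\<forall>z\<in>{2..r}. \<exists>\<tau>. is_simplex K (n - 1) \<tau> \<and> \<tau> \<subseteq> \<eta> (z - 1) \<and> \<tau> \<subseteq> \<eta> z"
    using assms unfolding simplicial_cycle_sequence_def face_of_simplex_def by blast
qed

theorem theorem4p1:
  fixes V :: "'a set" and K :: "'a set set" and m n :: nat
  assumes "1 \<le> n" and "m \<le> n - 1" and "pure_simplicial_complex n V K"
  shows "(\<exists>r \<sigma> \<eta>. simplicial_cycle_sequence K m n r \<sigma> \<eta>) \<longleftrightarrow>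
    (\<exists>(r::nat) (\<eta> :: nat \<Rightarrow> 'a set).
       r \<ge> 3 \<and> (\<forall>k\<in>{1..r}. is_simplex K n (\<eta> k)) \<and> inj_on \<eta> {1..r} \<and>
       (\<forall>z\<in>{2..r}. \<exists>\<tau>. is_simplex K (n - 1) \<tau> \<and>
          face_of_simplex \<tau> (\<eta> (z - 1)) \<and> face_of_simplex \<tau> (\<eta> z)) \<and>
       (\<exists>\<sigma>\<^sub>1. is_simplex K m \<sigma>\<^sub>1 \<and>
          face_of_simplex \<sigma>\<^sub>1 (\<eta> 1) \<and> face_of_simplex \<sigma>\<^sub>1 (\<eta> r) \<and>
          (\<exists>t\<in>{2..r - 1}. \<not> face_of_simplex \<sigma>\<^sub>1 (\<eta> t))))"
proof -
  have "simplicial_complex V K"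
    using assms(3) by (simp add: pure_simplicial_complex_def)
  then have "(\<exists>r \<sigma> \<eta>. simplicial_cycle_sequence K m n r \<sigma> \<eta>) \<longleftrightarrow>
      (\<exists>r \<eta> \<sigma>\<^sub>1. returning_path K m n r \<eta> \<sigma>\<^sub>1)"
    using returning_path_imp_cycle_sequence[OF assms(1,2)] cycle_sequence_imp_returning_path
    by blast
  then show ?thesis
    unfolding returning_path_def face_path_def face_of_simplex_def
    by (simp only: conj_assoc ex_simps)
qed

end
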